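(* Let $X$ be a partially ordered normed space with ordering cone $\mathcal{C}$, and let $x_0\in A\subset X$ be such that $A+\mathcal{C}$ is convex. Assume that $\mathcal{C}$ has a weakly compact base. If $(-\mathcal{C},\ \overline{\mathrm{cone}}(A-x_0+\mathcal{C}))$ has the strict separation property (SSP), then $x_0$ is a Henig global proper efficient point of $A$ (i.e. $x_0\in\mathrm{GHe}(A,\mathcal{C})$) if and only if there exists $(f,\alpha)\in\mathcal{C}^{a\#}_+$ such that $\min_{x\in A}\{f(x-x_0)+\alpha\|x-x_0\|\}$ is attained only at $x_0$.
   Context: $X$ is a real normed space with origin $0_X$, dual $X^*$ and unit sphere $S_X$. For $S\subset X$: $\overline S$ is the closure, $\mathrm{bd}(S)$ the boundary, $\mathrm{int}(S)$ the interior, $\mathrm{co}(S)$ the convex hull, $S_0:=S\cup\{0_X\}$, $\mathrm{cone}(S):=\{\lambda s:\lambda\ge0,\ s\in S\}$ and $\overline{\mathrm{cone}}(S)$ is its closure. A cone is a set closed under multiplication by all $\lambda\ge0$; all cones considered are assumed non-trivial (different from $\{0_X\}$ and $X$). A partially ordered normed space with ordering cone $\mathcal{C}$ is a normed space with a (non-trivial) convex cone $\mathcal{C}$ that is pointed, i.e. $(-\mathcal{C})\cap\mathcal{C}=\{0_X\}$. A base of a convex cone $\mathcal{C}$ is a non-empty convex $B\subset\mathcal{C}$ with $0_X\notin\overline B$ such that every $x\in\mathcal{C}\setminus\{0_X\}$ is uniquely of the form $x=\lambda b$ with $\lambda>0$, $b\in B$; $\mathcal{C}$ has a weakly compact base if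 some base is compact in the weak topology of $X$. $x_0\in\mathrm{GHe}(A,\mathcal{C})$ means $x_0\in A$ and there is a convex cone $\mathcal{K}$ with $\mathcal{C}\setminus\{0_X\}\subset\mathrm{int}(\mathcal{K})$ and $(x_0-\mathcal{K})\cap A=\{x_0\}$. For a cone $\mathcal{C}$, $\mathcal{C}_{\wedge}:=\mathrm{co}(\mathcal{C}\cap S_X)$ and $\mathcal{C}_{\vee}:=\mathrm{co}((\mathrm{bd}(\mathcal{C})\cap S_X)_0)$. The pair of cones $(\mathcal{C},\mathcal{K})$ has the strict separation property (SSP) if $0_X\notin\overline{\mathcal{C}_{\wedge}-\mathcal{K}_{\vee}}$ (Minkowski difference). $\mathcal{C}^{\#}:=\{f\in X^*: f(x)>0\ \forall x\in\mathcal{C},\ x\neq0_X\}$ and $\mathcal{C}^{a\#}_+:=\{(f,\alpha)\in\mathcal{C}^{\#}\times(0,\infty): f(x)-\alpha\|x\|>0\ \forall x\in\mathcal{C},\ x\neq0_X\}$. *)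

theory Defs
  imports "HOL-Analysis.Analysis"
begin

text \<open>
  On sets, unary and binary minus are complement and set difference; the reflected cone is therefore
  written as an image under \<^term>\<open>uminus\<close> and Minkowski sums and differences are set comprehensions.
\<close>

definition nontrivial_cone :: "'a::real_normed_vector set \<Rightarrow> bool" where
  "nontrivial_cone C \<longleftrightarrow> C \<noteq> {} \<and> conic C \<and> C \<noteq> {0} \<and> C \<noteq> UNIV"

definition ordering_cone :: "'a::real_normed_vector set \<Rightarrow> bool" where
  "ordering_cone C \<longleftrightarrow> nontrivial_cone C \<and> convex C \<and> uminus ` C \<inter> C = {0}"

definition cone_base :: "'a::real_normed_vector set \<Rightarrow> 'a set \<Rightarrow> bool" where
  "cone_base C B \<longleftrightarrow> B \<noteq> {} \<and> convex B \<and> B \<subseteq> C \<and> 0 \<notin> closure B \<and>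
     (\<forall>x\<in>C - {0}. \<exists>!p. fst p > 0 \<and> snd p \<in> B \<and> x = fst p *\<^sub>R snd p)"

text \<open>The coarsest topology making every continuous linear functional continuous.\<close>

definition weak_topology :: "'a::real_normed_vector topology" where
  "weak_topology = topology_generated_by
     {blinfun_apply f -` U | (f :: 'a \<Rightarrow>\<^sub>L real) U. open U}"

definition has_weakly_compact_base :: "'a::real_normed_vector set \<Rightarrow> bool" where
  "has_weakly_compact_base C \<longleftrightarrow> (\<exists>B. cone_base C B \<and> compactin weak_topology B)"

definition GHe :: "'a::real_normed_vector set \<Rightarrow> 'a set \<Rightarrow> 'a set" where
  "GHe A C = {x0 \<in> A. \<exists>K. nontrivial_cone K \<and> convex K \<and> C - {0} \<subseteq> interior K \<and>
     {x0 - k | k. k \<in> K} \<inter> A = {x0}}"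

definition cone_wedge :: "'a::real_normed_vector set \<Rightarrow> 'a set" where
  "cone_wedge C = convex hull (C \<inter> sphere 0 1)"

definition cone_vee :: "'a::real_normed_vector set \<Rightarrow> 'a set" where
  "cone_vee C = convex hull (insert 0 (frontier C \<inter> sphere 0 1))"

definition SSP :: "'a::real_normed_vector set \<Rightarrow> 'a set \<Rightarrow> bool" where
  "SSP C K \<longleftrightarrow> 0 \<notin> closure {u - v | u v. u \<in> cone_wedge C \<and> v \<in> cone_vee K}"

definition dual_sharp :: "'a::real_normed_vector set \<Rightarrow> ('a \<Rightarrow>\<^sub>L real) set" where
  "dual_sharp C = {f. \<forall>x\<in>C. x \<noteq> 0 \<longrightarrow> blinfun_apply f x > 0}"

definition aug_dual_sharp :: "'a::real_normed_vector set \<Rightarrow> (('a \<Rightarrow>\<^sub>L real) \<times> real) set" where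
  "aug_dual_sharp C = {(f, \<alpha>). f \<in> dual_sharp C \<and> \<alpha> > 0 \<and>
     (\<forall>x\<in>C. x \<noteq> 0 \<longrightarrow> blinfun_apply f x - \<alpha> * norm x > 0)}"

end

(* The forward direction separates the two convex sets of the strict separation property by a
   functional f. Since 0 lies in the second set, f is bounded below by a positive number on the unit
   vectors of C, and some alpha strictly below this bound makes g(v) = f v + alpha |v| positive on
   the nonzero boundary points of K, the closed cone generated by A - x0 + C. Efficiency gives a
   nonzero c in C with -c outside K. If g v <= 0 for a nonzero v in K, then by convexity g <= 0 at a
   point where the segment from v to -c crosses the boundary of K, a contradiction. Conversely,
   {k. f k > alpha |k|}, together with 0, is a dilating cone.

   Separation in a normed space comes from the Hahn-Banach theorem, proved by observing that a
   pointwise minimal sublinear functional is linear. *)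

theory Submission
  imports Defs
begin

section \<open>Separation in normed spaces\<close>

definition sublinear :: "('a::real_vector \<Rightarrow> real) \<Rightarrow> bool" where
  "sublinear p \<longleftrightarrow> (\<forall>x y. p (x + y) \<le> p x + p y) \<and> (\<forall>c x. c \<ge> 0 \<longrightarrow> p (c *\<^sub>R x) = c * p x)"

lemma sublinear_add: "sublinear p \<Longrightarrow> p (x + y) \<le> p x + p y"
  by (simp add: sublinear_def)

lemma sublinear_scaleR: "sublinear p \<Longrightarrow> c \<ge> 0 \<Longrightarrow> p (c *\<^sub>R x) = c * p x"
  by (simp add: sublinear_def)

lemma sublinear_0: "sublinear p \<Longrightarrow> p 0 = 0"
  using sublinear_scaleR[of p 0 0] by simp

lemma sublinear_ge: "sublinear p \<Longrightarrow> - p (- x) \<le> p x"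
  using sublinear_add[of p x "- x"] sublinear_0[of p] by simp

lemma sublinear_norm: "sublinear (norm :: 'a::real_normed_vector \<Rightarrow> real)"
  by (simp add: sublinear_def norm_triangle_ineq)

text \<open>For positive scalars one inequality suffices: applied to the inverse scalar, it yields
  the reverse one.\<close>

lemma sublinearI:
  assumes add: "\<And>x y. p (x + y) \<le> p x + p y"
    and scale: "\<And>c x. c > 0 \<Longrightarrow> p (c *\<^sub>R x) \<le> c * p x"
    and zero: "p 0 = 0"
  shows "sublinear p"
  unfolding sublinear_def
proof (intro conjI allI impI)
  fix c :: real and x assume "c \<ge> 0"
  show "p (c *\<^sub>R x) = c * p x"
  proof (cases "c = 0")
    case False
    with \<open>c \<ge> 0\<close> have c: "c > 0" by simp
    have "p x \<le> inverse c * p (c *\<^sub>R x)"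
      using scale[of "inverse c" "c *\<^sub>R x"] c by simp
    then have "c * p x \<le> p (c *\<^sub>R x)"
      using c by (simp add: field_simps)
    with scale[OF c, of x] show ?thesis by simp
  qed (simp add: zero)
qed (rule add)

text \<open>The largest sublinear functional below \<open>q\<close> whose value at \<open>- m\<close> is at most \<open>- r\<close> for
  all \<open>m\<close> in \<open>M\<close>.\<close>

definition sublinear_cut :: "('a::real_vector \<Rightarrow> real) \<Rightarrow> 'a set \<Rightarrow> real \<Rightarrow> 'a \<Rightarrow> real" where
  "sublinear_cut q M r x = (INF (t, m)\<in>{0..} \<times> M. q (x + t *\<^sub>R m) - t * r)"

context
  fixes q :: "'a::real_vector \<Rightarrow> real" and M :: "'a set" and r :: real
  assumes q: "sublinear q" and M: "convex M" "M \<noteq> {}" and r: "\<And>m. m \<in> M \<Longrightarrow> r \<le> q m"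
begin

text \<open>The lower bound does not depend on \<open>t\<close> or \<open>m\<close>, so the infimum
  in \<open>sublinear_cut\<close> is over a set bounded below.\<close>

lemma sublinear_cut_bound:
  assumes "t \<ge> 0" "m \<in> M"
  shows "- q (- x) \<le> q (x + t *\<^sub>R m) - t * r"
proof -
  have "t * r \<le> t * q m" using r assms by (simp add: mult_left_mono)
  also have "\<dots> = q (t *\<^sub>R m)" using q assms by (simp add: sublinear_scaleR)
  also have "\<dots> \<le> q (x + t *\<^sub>R m) + q (- x)"
    using sublinear_add[OF q, of "x + t *\<^sub>R m" "- x"] by simp
  finally show ?thesis by simp
qed

lemma sublinear_cut_le:
  assumes "t \<ge> 0" "m \<in> M"
  shows "sublinear_cut q M r x \<le> q (x + t *\<^sub>R m) - t * r"
proof -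
  have "bdd_below ((\<lambda>(t, m). q (x + t *\<^sub>R m) - t * r) ` ({0..} \<times> M))"
    by (rule bdd_belowI[of _ "- q (- x)"]) (auto simp: sublinear_cut_bound)
  from cINF_lower[OF this, of "(t, m)"] show ?thesis
    using assms by (simp add: sublinear_cut_def)
qed

lemma sublinear_cut_greatest:
  assumes "\<And>t m. t \<ge> 0 \<Longrightarrow> m \<in> M \<Longrightarrow> b \<le> q (x + t *\<^sub>R m) - t * r"
  shows "b \<le> sublinear_cut q M r x"
  unfolding sublinear_cut_def using M assms by (intro cINF_greatest) auto

lemma sublinear_cut_le_self: "sublinear_cut q M r x \<le> q x"
  using M sublinear_cut_le[of 0 _ x] by fastforce

lemma sublinear_sublinear_cut: "sublinear (sublinear_cut q M r)" (is "sublinear ?p")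
proof (rule sublinearI)
  fix x y
  have add: "?p (x + y) \<le> (q (x + s *\<^sub>R m) - s * r) + (q (y + t *\<^sub>R n) - t * r)"
    if st: "s \<ge> 0" "m \<in> M" "t \<ge> 0" "n \<in> M" for s t m n
  proof -
    \<comment> \<open>Convexity of \<open>M\<close> merges the two directions:
      \<open>s *\<^sub>R m + t *\<^sub>R n\<close> is \<open>s + t\<close> times a convex
      combination of \<open>m\<close> and \<open>n\<close>. If both weights vanish, any point of
      \<open>M\<close> serves.\<close>
    obtain k where k: "k \<in> M" "s *\<^sub>R m + t *\<^sub>R n = (s + t) *\<^sub>R k"
    proof (cases "s + t = 0")
      case True
      with st have "s = 0" "t = 0" by auto
      with st show ?thesis by (intro that[of m]) auto
    next
      case False
      have "(s / (s + t)) *\<^sub>R m + (t / (s + t)) *\<^sub>R n \<in> M"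
        using st False by (intro convexD[OF M(1)]) (auto simp flip: add_divide_distrib)
      moreover have "s *\<^sub>R m + t *\<^sub>R n = (s + t) *\<^sub>R ((s / (s + t)) *\<^sub>R m + (t / (s + t)) *\<^sub>R n)"
        using False by (simp add: scaleR_add_right)
      ultimately show ?thesis by (rule that)
    qed
    have "?p (x + y) \<le> q ((x + y) + (s + t) *\<^sub>R k) - (s + t) * r"
      using st k by (intro sublinear_cut_le) auto
    also have "(x + y) + (s + t) *\<^sub>R k = (x + s *\<^sub>R m) + (y + t *\<^sub>R n)"
      unfolding k(2)[symmetric] by (simp add: algebra_simps)
    finally show ?thesis
      using sublinear_add[OF q, of "x + s *\<^sub>R m" "y + t *\<^sub>R n"] by (simp add: algebra_simps)
  qed
  \<comment> \<open>The two infima are taken one after the other, first over \<open>(t, n)\<close>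
    and then over \<open>(s, m)\<close>.\<close>
  have "?p (x + y) - ?p y \<le> q (x + s *\<^sub>R m) - s * r" if "s \<ge> 0" "m \<in> M" for s m
  proof -
    have "?p (x + y) - (q (x + s *\<^sub>R m) - s * r) \<le> ?p y"
      using add[OF that] by (intro sublinear_cut_greatest) (simp add: algebra_simps)
    then show ?thesis by simp
  qed
  then have "?p (x + y) - ?p y \<le> ?p x"
    by (rule sublinear_cut_greatest)
  then show "?p (x + y) \<le> ?p x + ?p y" by simp
next
  fix c :: real and x assume c: "c > 0"
  have "inverse c * ?p (c *\<^sub>R x) \<le> q (x + t *\<^sub>R m) - t * r" if "t \<ge> 0" "m \<in> M" for t m
  proof -
    \<comment> \<open>The parameter \<open>t\<close> at \<open>x\<close> corresponds to
      \<open>c * t\<close> at \<open>c *\<^sub>R x\<close>.\<close>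
    have "?p (c *\<^sub>R x) \<le> q (c *\<^sub>R x + (c * t) *\<^sub>R m) - (c * t) * r"
      using that c by (intro sublinear_cut_le) auto
    also have "c *\<^sub>R x + (c * t) *\<^sub>R m = c *\<^sub>R (x + t *\<^sub>R m)"
      by (simp add: algebra_simps)
    also have "q \<dots> - (c * t) * r = c * (q (x + t *\<^sub>R m) - t * r)"
      unfolding sublinear_scaleR[OF q less_imp_le[OF c]] by (simp add: algebra_simps)
    finally show ?thesis using c by (simp add: field_simps)
  qed
  then have "inverse c * ?p (c *\<^sub>R x) \<le> ?p x"
    by (rule sublinear_cut_greatest)
  then show "?p (c *\<^sub>R x) \<le> c * ?p x" using c by (simp add: field_simps)
next
  have "0 \<le> ?p 0"
    using sublinear_cut_bound[of _ _ 0] by (intro sublinear_cut_greatest) (simp add: sublinear_0[OF q])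
  with sublinear_cut_le_self[of 0] show "?p 0 = 0" by (simp add: sublinear_0[OF q])
qed

end

section \<open>The Hahn-Banach theorem by Zorn's lemma\<close>

text \<open>The bound is the pointwise infimum, finite because each member satisfies
  \<open>- p (- x) \<le> - q (- x) \<le> q x\<close>. An infimum of sublinear functionals need not
  be subadditive; here it is, because of any two members of the chain one lies below both.\<close>

lemma sublinear_chain_bound:
  fixes p :: "'a::real_vector \<Rightarrow> real"
  assumes S: "S \<noteq> {}" "\<And>q. q \<in> S \<Longrightarrow> sublinear q \<and> q \<le> p"
    and chain: "\<And>q q'. q \<in> S \<Longrightarrow> q' \<in> S \<Longrightarrow> q \<le> q' \<or> q' \<le> q"
  obtains u where "sublinear u" "\<And>q. q \<in> S \<Longrightarrow> u \<le> q"
proof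
  define u where "u x = (INF q\<in>S. q x)" for x
  have bdd: "bdd_below ((\<lambda>q. q x) ` S)" for x
  proof (rule bdd_belowI[of _ "- p (- x)"])
    fix v assume "v \<in> (\<lambda>q. q x) ` S"
    then obtain q where q: "q \<in> S" "v = q x" by auto
    with S(2)[of q] sublinear_ge[of q x] le_funD[of q p "- x"] show "- p (- x) \<le> v" by fastforce
  qed
  have le: "u x \<le> q x" if "q \<in> S" for q x
    unfolding u_def using bdd that by (rule cINF_lower)
  have ge: "b \<le> u x" if "\<And>q. q \<in> S \<Longrightarrow> b \<le> q x" for b x
    unfolding u_def using S(1) that by (rule cINF_greatest)
  show "u \<le> q" if "q \<in> S" for q
    using le[OF that] by (rule le_funI)
  show "sublinear u"
  proof (rule sublinearI)
    fix x y
    have add: "u (x + y) \<le> q x + q' y" if q: "q \<in> S" "q' \<in> S" for q q'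
    proof -
      obtain k where k: "k \<in> S" "k \<le> q" "k \<le> q'"
        using chain[OF q] q by blast
      have "u (x + y) \<le> k x + k y"
        using le[OF k(1), of "x + y"] S(2)[OF k(1)] sublinear_add[of k x y] by simp
      then show ?thesis
        using le_funD[OF k(2), of x] le_funD[OF k(3), of y] by simp
    qed
    have "u (x + y) - u y \<le> q x" if "q \<in> S" for q
    proof -
      have "u (x + y) - q x \<le> u y"
        using add[OF that] by (intro ge) (simp add: algebra_simps)
      then show ?thesis by simp
    qed
    then have "u (x + y) - u y \<le> u x" by (rule ge)
    then show "u (x + y) \<le> u x + u y" by simp
  next
    fix c :: real and x assume c: "c > 0"
    have "inverse c * u (c *\<^sub>R x) \<le> q x" if "q \<in> S" for q
      using le[OF that, of "c *\<^sub>R x"] S(2)[OF that] c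
      by (simp add: sublinear_scaleR field_simps)
    then have "inverse c * u (c *\<^sub>R x) \<le> u x" by (rule ge)
    then show "u (c *\<^sub>R x) \<le> c * u x" using c by (simp add: field_simps)
  next
    have "q 0 = 0" if "q \<in> S" for q using S(2)[OF that] sublinear_0 by blast
    then have "(\<lambda>q. q 0) ` S = {0}" using S(1) by force
    then show "u 0 = 0" by (simp add: u_def)
  qed
qed

theorem Hahn_Banach_sublinear:
  fixes p :: "'a::real_vector \<Rightarrow> real"
  assumes p: "sublinear p"
  obtains f where "linear f" "\<And>x. f x \<le> p x"
proof -
  define Q where "Q = {q. sublinear q \<and> q \<le> p}"
  \<comment> \<open>The order is reversed, so that Zorn's maximal element is a pointwise minimal
    functional.\<close>
  define R where "R = relation_of (\<lambda>q q'. q' \<le> q) Q"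
  have "partial_order_on Q R"
    unfolding R_def by (rule partial_order_on_relation_ofI) auto
  moreover have "\<exists>u\<in>Q. \<forall>q\<in>S. u \<le> q" if S: "S \<in> Chains R" for S
  proof (cases "S = {}")
    case True
    then show ?thesis using p by (auto simp: Q_def)
  next
    case False
    have sub: "q \<in> Q" if "q \<in> S" for q
      using S that by (auto simp: Chains_def R_def relation_of_def)
    have chain: "q \<le> q' \<or> q' \<le> q" if "q \<in> S" "q' \<in> S" for q q'
      using S that by (auto simp: Chains_def R_def relation_of_def)
    obtain u where u: "sublinear u" "\<And>q. q \<in> S \<Longrightarrow> u \<le> q"
      using sublinear_chain_bound[OF False, of p] sub chain unfolding Q_def by blast
    obtain q where "q \<in> S" using False by blast
    then have "u \<le> p" using u(2)[of q] sub[of q] by (auto simp: Q_def)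
    with u show ?thesis by (auto simp: Q_def)
  qed
  ultimately obtain f where f: "f \<in> Q" and min: "\<And>q. q \<in> Q \<Longrightarrow> q \<le> f \<Longrightarrow> q = f"
    unfolding R_def using predicate_Zorn[of Q "\<lambda>q q'. q' \<le> q"] by blast
  have sub: "sublinear f" and le: "f \<le> p" using f by (auto simp: Q_def)
  have add: "f (x + y) = f x + f y" for x y
  proof -
    \<comment> \<open>This cut lies below \<open>f\<close>, so minimality makes them equal; its
      bound at \<open>t = 1\<close> then reads \<open>f x + f y \<le> f (x + y)\<close>, the missing
      half of additivity.\<close>
    let ?g = "sublinear_cut f {y} (f y)"
    have "?g \<le> f"
      by (rule le_funI, rule sublinear_cut_le_self) (auto simp: sub)
    moreover have "sublinear ?g"
      by (rule sublinear_sublinear_cut) (auto simp: sub)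
    ultimately have "?g = f" using le min by (auto simp: Q_def)
    moreover have "?g x \<le> f (x + 1 *\<^sub>R y) - 1 * f y"
      by (rule sublinear_cut_le) (auto simp: sub)
    ultimately show ?thesis using sublinear_add[OF sub, of x y] by simp
  qed
  have neg: "f (- x) = - f x" for x
    using add[of x "- x"] sublinear_0[OF sub] by simp
  have "f (c *\<^sub>R x) = c * f x" for c x
  proof (cases "c \<ge> 0")
    case False
    then show ?thesis
      using sublinear_scaleR[OF sub, of "- c" x] neg[of "c *\<^sub>R x"] by simp
  qed (simp add: sublinear_scaleR[OF sub])
  with add have "linear f" by (intro linearI) auto
  with le that show ?thesis by (auto simp: le_fun_def)
qed

text \<open>Cutting the norm along \<open>M\<close>, at a level \<open>r\<close> below the norms of
  all its points, gives a sublinear functional. A linear functional under it is dominated by the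
  norm, hence continuous, and is at most \<open>- r\<close> on \<open>- M\<close>.\<close>

lemma separating_functional_0:
  fixes M :: "'a::real_normed_vector set"
  assumes M: "convex M" "M \<noteq> {}" and 0: "0 \<notin> closure M"
  obtains f :: "'a \<Rightarrow>\<^sub>L real" and r where "r > 0" "\<And>m. m \<in> M \<Longrightarrow> r \<le> blinfun_apply f m"
proof -
  obtain r where r: "r > 0" "\<And>m. m \<in> M \<Longrightarrow> r \<le> norm m"
    using 0 unfolding closure_approachable by (force simp: not_less)
  let ?p = "sublinear_cut norm M r"
  note cut = sublinear_norm M r(2)
  obtain f where f: "linear f" "\<And>x. f x \<le> ?p x"
    using Hahn_Banach_sublinear[OF sublinear_sublinear_cut[OF cut]] by blast
  have le: "f x \<le> norm x" for x
    using f(2)[of x] sublinear_cut_le_self[OF cut, of x] by simp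
  have "\<bar>f x\<bar> \<le> norm x" for x
    using le[of x] le[of "- x"] linear_neg[OF f(1)] by (simp add: abs_le_iff)
  then have bl: "bounded_linear f"
    using f(1) by (intro bounded_linear_intro[of f 1]) (auto simp: linear_add linear_scale)
  have "r \<le> f m" if "m \<in> M" for m
  proof -
    have "?p (- m) \<le> norm (- m + 1 *\<^sub>R m) - 1 * r"
      using that by (intro sublinear_cut_le[OF cut]) auto
    then show ?thesis using f(2)[of "- m"] linear_neg[OF f(1)] by simp
  qed
  then show ?thesis
    using that[of r "Blinfun f"] r(1) bl by (simp add: bounded_linear_Blinfun_apply)
qed

section \<open>Cones\<close>

text \<open>Adding \<open>- k\<close> moves a ball around \<open>k\<close> inside \<open>K\<close>
  to a ball around 0 inside \<open>K\<close>, and scaling then reaches every vector.\<close>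

lemma convex_cone_eq_UNIV:
  fixes K :: "'a::real_normed_vector set"
  assumes K: "conic K" "convex K" and k: "k \<in> interior K" "- k \<in> K"
  shows "K = UNIV"
proof -
  have cc: "convex_cone K" using K k(2) by (auto simp: convex_cone_def)
  obtain e where e: "e > 0" "ball k e \<subseteq> K" using k(1) by (auto simp: mem_interior)
  have "x \<in> K" for x
  proof -
    define s where "s = e / (2 * (norm x + 1))"
    have s: "s > 0" using e(1) by (simp add: s_def add_nonneg_pos)
    have "norm (s *\<^sub>R x) < e"
    proof -
      have "s * norm x \<le> s * (norm x + 1)" using s by simp
      also have "\<dots> = e / 2" using norm_ge_zero[of x] by (simp add: s_def divide_simps; linarith)
      finally show ?thesis using s e(1) by simp
    qed
    then have "k + s *\<^sub>R x \<in> K" using e(2) by (auto simp: dist_norm)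
    then have "s *\<^sub>R x \<in> K" using convex_cone_add[OF cc _ k(2)] by fastforce
    from conicD[OF K(1) this, of "inverse s"] s show ?thesis by simp
  qed
  then show ?thesis by blast
qed

lemma conic_scaleR_image:
  assumes K: "conic K" and s: "s > 0"
  shows "(*\<^sub>R) s ` K = K"
proof
  show "(*\<^sub>R) s ` K \<subseteq> K" using K s by (auto simp: conic_def)
  show "K \<subseteq> (*\<^sub>R) s ` K"
  proof
    fix x assume "x \<in> K"
    then have "inverse s *\<^sub>R x \<in> K" using K s by (simp add: conic_def)
    then have "s *\<^sub>R (inverse s *\<^sub>R x) \<in> (*\<^sub>R) s ` K" by blast
    then show "x \<in> (*\<^sub>R) s ` K" using s by simp
  qed
qed

text \<open>Scaling by \<open>s > 0\<close> is a homeomorphism that maps \<open>K\<close> onto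
  itself, so it preserves closure and interior.\<close>

lemma conic_frontier_scaleR:
  fixes K :: "'a::real_normed_vector set"
  assumes K: "conic K" and s: "s > 0" and w: "w \<in> frontier K"
  shows "s *\<^sub>R w \<in> frontier K"
proof -
  have "s *\<^sub>R w \<in> closure K"
    using w closure_scaleR[of s K] conic_scaleR_image[OF K s] by (auto simp: frontier_def)
  moreover have "s *\<^sub>R w \<notin> interior K"
  proof
    assume "s *\<^sub>R w \<in> interior K"
    then have "inverse s *\<^sub>R (s *\<^sub>R w) \<in> (*\<^sub>R) (inverse s) ` interior K" by blast
    moreover have "(*\<^sub>R) (inverse s) ` interior K \<subseteq> K"
      using interior_subset[of K] conic_scaleR_image[OF K, of "inverse s"] s by auto
    moreover have "open ((*\<^sub>R) (inverse s) ` interior K)"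
      using s by (intro open_scaling) auto
    ultimately have "inverse s *\<^sub>R (s *\<^sub>R w) \<in> interior K"
      by (meson interior_maximal subsetD)
    then have "w \<in> interior K" using s by simp
    with w show False by (simp add: frontier_def)
  qed
  ultimately show ?thesis by (simp add: frontier_def)
qed

lemma conic_closure_normed:
  fixes K :: "'a::real_normed_vector set"
  assumes "conic K" "K \<noteq> {}"
  shows "conic (closure K)"
  unfolding conic_def
proof (intro allI impI)
  fix x and s :: real assume x: "x \<in> closure K" and s: "0 \<le> s"
  show "s *\<^sub>R x \<in> closure K"
  proof (cases "s = 0")
    case True
    then show ?thesis using conic_contains_0[OF assms(1)] assms(2) closure_subset by auto
  next
    case False
    then show ?thesis
      using x s closure_scaleR[of s K] conic_scaleR_image[OF assms(1), of s] by auto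
  qed
qed

section \<open>From strict separation to a functional in the augmented dual cone\<close>

lemma SSP_functional:
  fixes C K :: "'a::real_normed_vector set"
  assumes C: "nontrivial_cone C" and K: "conic K" and SSP: "SSP (uminus ` C) K"
  obtains f \<alpha> where "(f, \<alpha>) \<in> aug_dual_sharp C"
    "\<And>v. v \<in> frontier K \<Longrightarrow> v \<noteq> 0 \<Longrightarrow> 0 < blinfun_apply f v + \<alpha> * norm v"
proof -
  define U where "U = cone_wedge (uminus ` C)"
  define V where "V = cone_vee K"
  define M where "M = {u - v | u v. u \<in> U \<and> v \<in> V}"
  have unit: "(1 / norm c) *\<^sub>R c \<in> C" if "c \<in> C" for c
    using C that by (auto simp: nontrivial_cone_def conic_def)
  have inU: "- c \<in> U" if "c \<in> C" "norm c = 1" for c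
    using that unfolding U_def cone_wedge_def by (intro hull_inc) auto
  have inV: "v \<in> V" if "v = 0 \<or> v \<in> frontier K \<and> norm v = 1" for v
    using that unfolding V_def cone_vee_def by (intro hull_inc) auto
  obtain c0 where c0: "c0 \<in> C" "c0 \<noteq> 0" using C by (auto simp: nontrivial_cone_def)
  have c1: "(1 / norm c0) *\<^sub>R c0 \<in> C" "norm ((1 / norm c0) *\<^sub>R c0) = 1" using unit c0 by auto
  have "M = (\<Union>u\<in>U. \<Union>v\<in>V. {u - v})" by (auto simp: M_def)
  then have "convex M"
    using convex_differences[of U V] by (simp add: U_def V_def cone_wedge_def cone_vee_def)
  moreover have "M \<noteq> {}" using inU[OF c1] inV[of 0] by (auto simp: M_def)
  moreover have "0 \<notin> closure M" using SSP by (simp add: SSP_def M_def U_def V_def)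
  ultimately obtain g :: "'a \<Rightarrow>\<^sub>L real" and r
    where r: "r > 0" and g: "\<And>m. m \<in> M \<Longrightarrow> r \<le> blinfun_apply g m"
    by (rule separating_functional_0) blast
  \<comment> \<open>Points of \<open>M\<close> have the form \<open>- c - v\<close> for unit vectors
    \<open>c\<close> of \<open>C\<close>; the sign change turns the bound on \<open>g\<close> into
    one on \<open>f c + f v\<close>.\<close>
  define f where "f = - g"
  have sep: "r \<le> f c + f v" if "c \<in> C" "norm c = 1" "v = 0 \<or> v \<in> frontier K \<and> norm v = 1" for c v
    using g[of "- c - v"] inU[OF that(1,2)] inV[OF that(3)]
    by (fastforce simp: f_def M_def blinfun.diff_right blinfun.minus_right blinfun.minus_left)
  define \<beta> where "\<beta> = (INF c\<in>C \<inter> sphere 0 1. f c)"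
  have ne: "C \<inter> sphere 0 1 \<noteq> {}" using c1 by auto
  have "r \<le> f c" if "c \<in> C" "norm c = 1" for c
    using sep[OF that, of 0] by simp
  then have \<beta>_le: "\<beta> \<le> f c" if "c \<in> C" "norm c = 1" for c
    unfolding \<beta>_def using that by (intro cINF_lower bdd_belowI[of _ r]) auto
  have \<beta>_ge: "r \<le> \<beta> + f v" if "v = 0 \<or> v \<in> frontier K \<and> norm v = 1" for v
  proof -
    have "r - f v \<le> \<beta>"
      unfolding \<beta>_def using ne sep[OF _ _ that] by (intro cINF_greatest) (auto simp: algebra_simps)
    then show ?thesis by simp
  qed
  have \<beta>: "\<beta> > 0" using \<beta>_ge[of 0] r by simp
  \<comment> \<open>\<open>\<alpha> < \<beta>\<close> keeps \<open>f\<close> above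
    \<open>\<alpha>\<close> on unit vectors of \<open>C\<close>, while
    \<open>\<beta> - r < \<alpha>\<close> gives \<open>f v \<ge> r - \<beta> > - \<alpha>\<close> on
    unit frontier vectors. The interval is non-empty since \<open>r\<close> and
    \<open>\<beta>\<close> are positive.\<close>
  obtain \<alpha> where \<alpha>: "max 0 (\<beta> - r) < \<alpha>" "\<alpha> < \<beta>"
    using dense[of "max 0 (\<beta> - r)" \<beta>] r \<beta> by auto
  show ?thesis
  proof (rule that)
    have "0 < f c - \<alpha> * norm c" if "c \<in> C" "c \<noteq> 0" for c
    proof -
      have "\<alpha> < f ((1 / norm c) *\<^sub>R c)"
        using \<beta>_le[of "(1 / norm c) *\<^sub>R c"] unit[OF that(1)] that \<alpha> by simp
      then show ?thesis using that by (simp add: blinfun.scaleR_right field_simps)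
    qed
    moreover from this have "0 < f c" if "c \<in> C" "c \<noteq> 0" for c
      using that \<alpha> by (smt (verit) mult_nonneg_nonneg norm_ge_zero)
    ultimately show "(f, \<alpha>) \<in> aug_dual_sharp C"
      using \<alpha> by (simp add: aug_dual_sharp_def dual_sharp_def)
  next
    fix v assume v: "v \<in> frontier K" "v \<noteq> 0"
    have "(1 / norm v) *\<^sub>R v \<in> frontier K" using v K by (intro conic_frontier_scaleR) auto
    then have "- \<alpha> < f ((1 / norm v) *\<^sub>R v)"
      using \<beta>_ge[of "(1 / norm v) *\<^sub>R v"] v \<alpha> by simp
    then show "0 < f v + \<alpha> * norm v" using v by (simp add: blinfun.scaleR_right field_simps)
  qed
qed

lemma pos_on_cone_if_pos_on_frontier:
  fixes C K :: "'a::real_normed_vector set"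
  assumes f\<alpha>: "(f, \<alpha>) \<in> aug_dual_sharp C"
    and fr: "\<And>v. v \<in> frontier K \<Longrightarrow> v \<noteq> 0 \<Longrightarrow> 0 < blinfun_apply f v + \<alpha> * norm v"
    and c: "c \<in> C" "c \<noteq> 0" "- c \<notin> K"
    and v: "v \<in> K" "v \<noteq> 0"
  shows "0 < blinfun_apply f v + \<alpha> * norm v"
proof (rule ccontr)
  assume neg: "\<not> ?thesis"
  have \<alpha>: "\<alpha> > 0" and fc: "f c > 0" and gc: "f c - \<alpha> * norm c > 0"
    using f\<alpha> c by (auto simp: aug_dual_sharp_def dual_sharp_def)
  have "\<alpha> * norm v > 0" using \<alpha> v by simp
  then have fv: "f v < 0" using neg by linarith
  \<comment> \<open>The segment is connected and joins a point of \<open>K\<close> to a point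
    outside \<open>K\<close>.\<close>
  have "closed_segment v (- c) \<inter> frontier K \<noteq> {}"
    using v c by (intro connected_Int_frontier) auto
  then obtain t where t: "0 \<le> t" "t \<le> 1" and w: "(1 - t) *\<^sub>R v + t *\<^sub>R (- c) \<in> frontier K"
    by (auto simp: closed_segment_def)
  let ?w = "(1 - t) *\<^sub>R v + t *\<^sub>R (- c)"
  have fw: "f ?w = (1 - t) * f v - t * f c"
    by (simp add: blinfun.add_right blinfun.diff_right blinfun.minus_right blinfun.scaleR_right)
  \<comment> \<open>This excludes \<open>?w = 0\<close>, a point at which \<open>fr\<close> gives no
    information.\<close>
  have "f ?w < 0"
  proof (cases "t = 0")
    case False
    then have "t * f c > 0" using t fc by simp
    moreover have "(1 - t) * f v \<le> 0" using t fv by (simp add: mult_nonneg_nonpos)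
    ultimately show ?thesis unfolding fw by linarith
  qed (use fv fw in simp)
  then have "?w \<noteq> 0" by (metis blinfun.zero_right less_irrefl)
  with fr w have pos: "0 < f ?w + \<alpha> * norm ?w" by blast
  have "norm ?w \<le> (1 - t) * norm v + t * norm c"
    using norm_triangle_ineq[of "(1 - t) *\<^sub>R v" "t *\<^sub>R (- c)"] t by simp
  then have "\<alpha> * norm ?w \<le> \<alpha> * ((1 - t) * norm v + t * norm c)"
    using \<alpha> by (intro mult_left_mono) auto
  \<comment> \<open>The right-hand side is the convex combination of the values of
    \<open>f + \<alpha> * norm\<close> at \<open>v\<close> and \<open>- c\<close>, neither of which
    is positive.\<close>
  with pos have "0 < (1 - t) * (f v + \<alpha> * norm v) - t * (f c - \<alpha> * norm c)"
    unfolding fw by (simp add: algebra_simps)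
  moreover have "(1 - t) * (f v + \<alpha> * norm v) \<le> 0"
    using t neg by (intro mult_nonneg_nonpos) auto
  moreover have "0 \<le> t * (f c - \<alpha> * norm c)"
    using t gc by (intro mult_nonneg_nonneg) auto
  ultimately show False by linarith
qed

section \<open>Henig efficiency\<close>

text \<open>The reflected interior of the dilating cone is open and misses the generated cone, hence
  also its closure; yet it contains \<open>- c0\<close>.\<close>

lemma GHe_neg_notin_closure:
  fixes C A :: "'a::real_normed_vector set"
  assumes "conic C" "x0 \<in> GHe A C" and c0: "c0 \<in> C" "c0 \<noteq> 0"
  shows "- c0 \<notin> closure (conic hull {a - x0 + c | a c. a \<in> A \<and> c \<in> C})" (is "_ \<notin> closure ?D")
proof -
  obtain K where K: "nontrivial_cone K" "convex K" and int: "C - {0} \<subseteq> interior K"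
    and eff: "{x0 - k | k. k \<in> K} \<inter> A = {x0}"
    using assms(2) by (auto simp: GHe_def)
  have K': "K \<noteq> {}" "conic K" "K \<noteq> UNIV" using K(1) by (auto simp: nontrivial_cone_def)
  have cc: "convex_cone K" using K(2) K' by (auto simp: convex_cone_def)
  have CK: "c \<in> K" if "c \<in> C" for c
    using that int interior_subset[of K] convex_cone_contains_0[OF cc] by (cases "c = 0") auto
  have nin: "- d \<notin> interior K" if D: "d \<in> ?D" for d
  proof
    assume k: "- d \<in> interior K"
    then have kK: "- d \<in> K" using interior_subset by blast
    obtain s a c where s: "s \<ge> 0" and d: "d = s *\<^sub>R (a - x0 + c)" and a: "a \<in> A" and c: "c \<in> C"
      using D unfolding conic_hull_explicit by blast
    \<comment> \<open>Once \<open>d\<close> is in \<open>K\<close> as well, \<open>K\<close> would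
      be the whole space. For \<open>s > 0\<close>, rescaling \<open>- d\<close> and adding
      \<open>c\<close> puts \<open>x0 - a\<close> in \<open>K\<close>, so efficiency forces
      \<open>a = x0\<close> and \<open>d = s *\<^sub>R c\<close>.\<close>
    have "d \<in> K"
    proof (cases "s = 0")
      case True
      then show ?thesis using d kK by simp
    next
      case False
      have "inverse s *\<^sub>R (- d) \<in> K" using s by (intro conicD[OF K'(2) kK]) simp
      then have "x0 - a - c \<in> K" using False d by (simp add: algebra_simps)
      then have "x0 - a \<in> K" using convex_cone_add[OF cc _ CK[OF c]] by fastforce
      moreover have "a = x0 - (x0 - a)" by simp
      ultimately have "a \<in> {x0 - k | k. k \<in> K} \<inter> A" using a by blast
      then have "a = x0" using eff by simp
      then show ?thesis using d CK[OF c] K'(2) s by (simp add: conic_def)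
    qed
    then show False using convex_cone_eq_UNIV[OF K'(2) K(2) k] K'(3) by simp
  qed
  have "open (uminus ` interior K)" by (simp add: open_negations)
  moreover have "uminus ` interior K \<inter> ?D = {}" using nin by force
  ultimately have "uminus ` interior K \<inter> closure ?D = {}"
    using open_Int_closure_eq_empty by blast
  moreover have "- c0 \<in> uminus ` interior K" using int c0 by auto
  ultimately show ?thesis by blast
qed

lemma GHe_if_pos:
  fixes C A :: "'a::real_normed_vector set"
  assumes C: "nontrivial_cone C" and x0: "x0 \<in> A" and f\<alpha>: "(f, \<alpha>) \<in> aug_dual_sharp C"
    and min: "\<And>a. a \<in> A \<Longrightarrow> 0 \<le> blinfun_apply f (a - x0) + \<alpha> * norm (a - x0)"
  shows "x0 \<in> GHe A C"
proof -
  define P where "P = {k. blinfun_apply f k > \<alpha> * norm k}"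
  \<comment> \<open>The strict inequality makes \<open>P\<close> open but excludes 0, which a cone
    must contain.\<close>
  define K where "K = insert 0 P"
  have \<alpha>: "\<alpha> > 0" and CP: "C - {0} \<subseteq> P"
    using f\<alpha> by (auto simp: aug_dual_sharp_def P_def)
  obtain c0 where c0: "c0 \<in> C" "c0 \<noteq> 0" using C by (auto simp: nontrivial_cone_def)
  have posP: "f k > 0" if "k \<in> P" for k
    using that \<alpha> unfolding P_def
    by (metis less_le_trans less_irrefl mem_Collect_eq mult_nonneg_nonneg norm_ge_zero not_le less_imp_le)
  have conic: "conic K"
    unfolding conic_def K_def
  proof (intro allI impI)
    fix x and s :: real assume "x \<in> insert 0 P" "0 \<le> s"
    then show "s *\<^sub>R x \<in> insert 0 P"
      by (cases "s = 0") (auto simp: P_def blinfun.scaleR_right)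
  qed
  \<comment> \<open>Closure under addition comes from the triangle inequality; with
    \<open>conic\<close> it yields convexity.\<close>
  have "x + y \<in> K" if "x \<in> K" "y \<in> K" for x y
  proof (cases "x = 0 \<or> y = 0")
    case False
    then have "x \<in> P" "y \<in> P" using that by (auto simp: K_def)
    moreover have "\<alpha> * norm (x + y) \<le> \<alpha> * norm x + \<alpha> * norm y"
      using \<alpha> norm_triangle_ineq[of x y] by (simp flip: distrib_left)
    ultimately show ?thesis by (auto simp: K_def P_def blinfun.add_right)
  qed (use that in auto)
  then have "convex K"
    using conic unfolding convex_def conic_def by simp
  moreover have "nontrivial_cone K"
  proof -
    have "c0 \<in> K" using c0 CP by (auto simp: K_def)
    \<comment> \<open>Otherwise \<open>f\<close> would be positive at both \<open>c0\<close> and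
      \<open>- c0\<close>.\<close>
    moreover have "- c0 \<notin> K"
      using posP[of "- c0"] posP[of c0] c0 CP by (auto simp: K_def blinfun.minus_right)
    ultimately show ?thesis using conic c0 unfolding nontrivial_cone_def by blast
  qed
  moreover have "C - {0} \<subseteq> interior K"
  proof -
    have "open P" unfolding P_def by (intro open_Collect_less continuous_intros)
    then have "P \<subseteq> interior K" by (intro interior_maximal) (auto simp: K_def)
    with CP show ?thesis by blast
  qed
  moreover have "{x0 - k | k. k \<in> K} \<inter> A = {x0}"
  proof -
    \<comment> \<open>A point \<open>k\<close> of \<open>P\<close> would make the objective at
      \<open>x0 - k\<close> equal to \<open>- f k + \<alpha> * norm k < 0\<close>, against
      \<open>min\<close>.\<close>
    have "k = 0" if "k \<in> K" "x0 - k \<in> A" for k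
      using min[OF that(2)] that(1) by (auto simp: K_def P_def blinfun.minus_right)
    moreover have "0 \<in> K" by (simp add: K_def)
    ultimately show ?thesis using x0 by force
  qed
  ultimately show ?thesis using x0 unfolding GHe_def by blast
qed

theorem corollary3p10:
  fixes C A :: "'a::real_normed_vector set" and x0 :: 'a
  assumes "ordering_cone C"
    and "x0 \<in> A"
    and "convex {a + c | a c. a \<in> A \<and> c \<in> C}"
    and "has_weakly_compact_base C"
    and "SSP (uminus ` C) (closure (conic hull {a - x0 + c | a c. a \<in> A \<and> c \<in> C}))"
  shows "x0 \<in> GHe A C \<longleftrightarrow>
    (\<exists>(f, \<alpha>) \<in> aug_dual_sharp C.
       {x. is_arg_min (\<lambda>x. blinfun_apply f (x - x0) + \<alpha> * norm (x - x0)) (\<lambda>x. x \<in> A) x} = {x0})"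
proof
  let ?E = "{a - x0 + c | a c. a \<in> A \<and> c \<in> C}"
  let ?K = "closure (conic hull ?E)"
  have C: "nontrivial_cone C" using assms(1) by (simp add: ordering_cone_def)
  then have "conic C" "C \<noteq> {}" by (auto simp: nontrivial_cone_def)
  then have 0: "0 \<in> C" by (simp add: conic_contains_0)
  {
    assume ghe: "x0 \<in> GHe A C"
    have "?E \<noteq> {}" using assms(2) 0 by blast
    then have "conic ?K"
      by (intro conic_closure_normed conic_conic_hull) (simp add: conic_hull_eq_empty)
    then obtain f \<alpha> where f\<alpha>: "(f, \<alpha>) \<in> aug_dual_sharp C"
      and fr: "\<And>v. v \<in> frontier ?K \<Longrightarrow> v \<noteq> 0 \<Longrightarrow> 0 < blinfun_apply f v + \<alpha> * norm v"
      using SSP_functional[OF C _ assms(5)] by blast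
    obtain c where c: "c \<in> C" "c \<noteq> 0" using C by (auto simp: nontrivial_cone_def)
    have pos: "0 < f (a - x0) + \<alpha> * norm (a - x0)" if "a \<in> A" "a \<noteq> x0" for a
    proof (rule pos_on_cone_if_pos_on_frontier[OF f\<alpha> fr c])
      show "- c \<notin> ?K" by (rule GHe_neg_notin_closure) fact+
      \<comment> \<open>The choice \<open>c = 0\<close> embeds \<open>A - x0\<close> in
        \<open>?E\<close>.\<close>
      have "\<exists>a' c. a - x0 = a' - x0 + c \<and> a' \<in> A \<and> c \<in> C"
        using that 0 by (intro exI[of _ a] exI[of _ 0]) auto
      then have "a - x0 \<in> conic hull ?E" by (intro hull_inc) simp
      then show "a - x0 \<in> ?K" by (rule subsetD[OF closure_subset])
    qed (use that in auto)
    then have "0 \<le> f (a - x0) + \<alpha> * norm (a - x0)" if "a \<in> A" for a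
      using that by (cases "a = x0") (auto intro: less_imp_le)
    then have "{x. is_arg_min (\<lambda>x. f (x - x0) + \<alpha> * norm (x - x0)) (\<lambda>x. x \<in> A) x} = {x0}"
      using pos assms(2) by (fastforce simp: is_arg_min_def not_less)
    with f\<alpha> show "\<exists>(f, \<alpha>) \<in> aug_dual_sharp C.
       {x. is_arg_min (\<lambda>x. blinfun_apply f (x - x0) + \<alpha> * norm (x - x0)) (\<lambda>x. x \<in> A) x} = {x0}"
      by blast
  }
  {
    assume "\<exists>(f, \<alpha>) \<in> aug_dual_sharp C.
       {x. is_arg_min (\<lambda>x. blinfun_apply f (x - x0) + \<alpha> * norm (x - x0)) (\<lambda>x. x \<in> A) x} = {x0}"
    then obtain f \<alpha> where f\<alpha>: "(f, \<alpha>) \<in> aug_dual_sharp C"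
      and "is_arg_min (\<lambda>x. blinfun_apply f (x - x0) + \<alpha> * norm (x - x0)) (\<lambda>x. x \<in> A) x0"
      by blast
    \<comment> \<open>The objective vanishes at \<open>x0\<close>, so its minimal value is
      0.\<close>
    then have "0 \<le> f (a - x0) + \<alpha> * norm (a - x0)" if "a \<in> A" for a
      using that by (auto simp: is_arg_min_def not_less)
    with C assms(2) f\<alpha> show "x0 \<in> GHe A C" by (rule GHe_if_pos)
  }
qed

end
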